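(* Let $X \xrightarrow{f} Z \xleftarrow{g} Y$ be continuous maps. Then: (1) $\mathrm{TC}_H(f,g)\le \mathrm{TC}(f,g)$. (2) If at least one of $f$ or $g$ is a fibration, then $\mathrm{TC}_H(f,g)=\mathrm{secat}(\pi_{f,g})$. (3) If both $f$ and $g$ are fibrations, then $\mathrm{TC}_H(f,g)=\mathrm{TC}(f,g)$.
   Context: All maps are continuous, $I=[0,1]$, path spaces $X^I$ carry the compact-open topology, and fibration means Hurewicz fibration. For a map $p\colon E\to B$, the sectional number $\mathrm{sec}(p)$ is the least integer $k\ge 0$ such that $B$ has an open cover $U_0,\dots,U_k$ with continuous maps $s_i\colon U_i\to E$ satisfying $p\circ s_i=\mathrm{inc}_{U_i}$ (strict equality); the sectional category $\mathrm{secat}(p)$ is defined in the same way but requiring only $p\circ s_i\simeq\mathrm{inc}_{U_i}$; both are $\infty$ if no such $k$ exists. Put $\Delta^I_{f,g}=\{(\alpha,\beta)\in X^I\times Y^I : f\circ\alpha=g\circ\beta\}$ and $\pi_{f,g}\colon\Delta^I_{f,g}\to X\times Y$, $\pi_{f,g}(\alpha,\beta)=(\alpha(0),\beta(1))$; then $\mathrm{TC}(f,g):=\mathrm{sec}(\pi_{f,g})$. A subset $A\subseteq X\times Y$ is $(f,g)$-sectional if there is a continuous map $\sigma\colon A\to Z^I$ with $\sigma(x,y)(0)=f(x)$ and $\sigma(x,y)(1)=g(y)$ for all $(x,y)\in A$. The homotopy bivariate topological complexity $\mathrm{TC}_H(f,g)$ is the least integer $k\ge 0$ such that $X\times Y$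 can be covered by $k+1$ open $(f,g)$-sectional subsets, and $\infty$ if no such $k$ exists. *)

theory Defs
  imports "HOL-Analysis.Analysis"
begin

section \<open>Path spaces with the compact-open topology\<close>

abbreviation unit_interval :: "real topology" where
  "unit_interval \<equiv> top_of_set {0..1}"

text \<open>Paths are functions on all of \<^typ>\<open>real\<close>; requiring them to be \<^const>\<open>extensional\<close> on
  the unit interval makes points of the path space correspond one-to-one to maps $I \to X$.
  The whole set of paths is the subbasic set for the empty compact set, so that the topology
  has the paths as its carrier (see topspace_path_space).\<close>

definition paths :: "'a topology \<Rightarrow> (real \<Rightarrow> 'a) set" where
  "paths X = {\<gamma>. pathin X \<gamma> \<and> \<gamma> \<in> extensional {0..1}}"

definition path_space :: "'a topology \<Rightarrow> (real \<Rightarrow> 'a) topology" where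
  "path_space X = topology_generated_by
     {{\<gamma> \<in> paths X. \<gamma> ` K \<subseteq> U} | K U. compactin unit_interval K \<and> openin X U}"

lemma topspace_path_space [simp]: "topspace (path_space X) = paths X"
  unfolding path_space_def topology_generated_by_topspace
proof
  let ?S = "{{\<gamma> \<in> paths X. \<gamma> ` K \<subseteq> U} | K U. compactin unit_interval K \<and> openin X U}"
  have "paths X = {\<gamma> \<in> paths X. \<gamma> ` {} \<subseteq> topspace X}"
    by simp
  moreover have "compactin unit_interval {}" "openin X (topspace X)"
    by simp_all
  ultimately have "paths X \<in> ?S"
    by blast
  then show "paths X \<subseteq> \<Union>?S"
    by (rule Union_upper)
qed blast

lemma openin_path_space_subbasic:
  assumes "compactin unit_interval K" "openin X U"
  shows "openin (path_space X) {\<gamma> \<in> paths X. \<gamma> ` K \<subseteq> U}"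
  unfolding path_space_def using assms by (intro topology_generated_by_Basis) auto

lemma continuous_map_path_eval:
  "continuous_map (prod_topology (path_space X) unit_interval) X (\<lambda>(\<gamma>, t). \<gamma> t)"
  unfolding continuous_map_def
proof (intro conjI allI impI)
  show "(\<lambda>(\<gamma>, t). \<gamma> t) \<in> topspace (prod_topology (path_space X) unit_interval) \<rightarrow> topspace X"
    by (auto simp: paths_def pathin_def continuous_map_def)
next
  fix U assume U: "openin X U"
  let ?S = "{z \<in> topspace (prod_topology (path_space X) unit_interval). (case z of (\<gamma>, t) \<Rightarrow> \<gamma> t) \<in> U}"
  show "openin (prod_topology (path_space X) unit_interval) ?S"
    unfolding openin_prod_topology_alt
  proof (intro allI impI)
    fix \<gamma> t assume "(\<gamma>, t) \<in> ?S"
    then have g: "\<gamma> \<in> paths X" and t: "t \<in> {0..1}" and tU: "\<gamma> t \<in> U"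
      by auto
    have "openin unit_interval {s \<in> {0..1}. \<gamma> s \<in> U}"
      using g U openin_continuous_map_preimage[of unit_interval X \<gamma> U]
      by (simp add: paths_def pathin_def)
    then have "\<forall>r \<in> {s \<in> {0..1}. \<gamma> s \<in> U}. \<exists>e>0. \<forall>s \<in> {0..1}. dist s r < e \<longrightarrow> s \<in> {s \<in> {0..1}. \<gamma> s \<in> U}"
      unfolding openin_euclidean_subtopology_iff by (rule conjunct2)
    moreover have "t \<in> {s \<in> {0..1}. \<gamma> s \<in> U}"
      using t tU by simp
    ultimately have "\<exists>e>0. \<forall>s \<in> {0..1}. dist s t < e \<longrightarrow> s \<in> {s \<in> {0..1}. \<gamma> s \<in> U}"
      by (rule bspec)
    then obtain e where "e > 0" "\<forall>s \<in> {0..1}. dist s t < e \<longrightarrow> s \<in> {s \<in> {0..1}. \<gamma> s \<in> U}"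
      by blast
    then have e: "e > 0" "\<And>s. s \<in> {0..1} \<Longrightarrow> dist s t < e \<Longrightarrow> \<gamma> s \<in> U"
      by blast+
    define K where "K = {0..1} \<inter> cball t (e/2)"
    define J where "J = {0..1} \<inter> ball t (e/2)"
    have K: "compactin unit_interval K"
      unfolding K_def compactin_subtopology by (auto intro: compact_Int)
    have J: "openin unit_interval J"
      unfolding J_def by (intro openin_open_Int) auto
    have "\<gamma> ` K \<subseteq> U"
      using e by (auto simp: K_def dist_commute)
    moreover have "t \<in> J" using t e by (auto simp: J_def)
    moreover have "J \<subseteq> K" "J \<subseteq> {0..1}" by (auto simp: J_def K_def)
    ultimately show "\<exists>V J. openin (path_space X) V \<and> openin unit_interval J \<and> \<gamma> \<in> V \<and> t \<in> J \<and> V \<times> J \<subseteq> ?S"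
      using openin_path_space_subbasic[OF K U] J g
      by (intro exI[of _ "{\<gamma> \<in> paths X. \<gamma> ` K \<subseteq> U}"] exI[of _ J]) (auto simp: image_subset_iff)
  qed
qed

lemma continuous_map_into_path_space:
  assumes H: "continuous_map (prod_topology W unit_interval) X (\<lambda>(w, t). H w t)"
  shows "continuous_map W (path_space X) (\<lambda>w. restrict (H w) {0..1})"
proof -
  have path: "restrict (H w) {0..1} \<in> paths X" if "w \<in> topspace W" for w
  proof -
    have "continuous_map unit_interval (prod_topology W unit_interval) (\<lambda>t. (w, t))"
      using that by (simp add: continuous_map_pairwise o_def)
    from continuous_map_compose[OF this H] have "continuous_map unit_interval X (H w)"
      by (simp add: o_def)
    then have "continuous_map unit_interval X (restrict (H w) {0..1})"
      by (rule continuous_map_eq) auto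
    then show ?thesis by (simp add: paths_def pathin_def)
  qed
  show ?thesis
    unfolding path_space_def
  proof (rule continuous_on_generated_topo)
    show "(\<lambda>w. restrict (H w) {0..1}) ` topspace W
        \<subseteq> \<Union> {{\<gamma> \<in> paths X. \<gamma> ` K \<subseteq> U} |K U. compactin unit_interval K \<and> openin X U}"
      using path topspace_path_space[of X]
      unfolding path_space_def topology_generated_by_topspace by auto
  next
    fix S assume "S \<in> {{\<gamma> \<in> paths X. \<gamma> ` K \<subseteq> U} |K U. compactin unit_interval K \<and> openin X U}"
    then obtain K U where S: "S = {\<gamma> \<in> paths X. \<gamma> ` K \<subseteq> U}"
      and K: "compactin unit_interval K" and U: "openin X U" by blast
    have K01: "K \<subseteq> {0..1}" using K compactin_subset_topspace by fastforce
    let ?P = "{z \<in> topspace (prod_topology W unit_interval). (\<lambda>(w, t). H w t) z \<in> U}"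
    have P: "openin (prod_topology W unit_interval) ?P"
      by (rule openin_continuous_map_preimage[OF H U])
    show "openin W ((\<lambda>w. restrict (H w) {0..1}) -` S \<inter> topspace W)"
      unfolding openin_subopen[of _ "(\<lambda>w. restrict (H w) {0..1}) -` S \<inter> topspace W"]
    proof
      fix w assume w: "w \<in> (\<lambda>w. restrict (H w) {0..1}) -` S \<inter> topspace W"
      then have wW: "w \<in> topspace W" and wK: "restrict (H w) {0..1} ` K \<subseteq> U"
        unfolding S by blast+
      have "H w t \<in> U" if "t \<in> K" for t
        using subsetD[OF wK imageI[OF that]] subsetD[OF K01 that] by simp
      then have "{w} \<times> K \<subseteq> ?P"
        using K01 wW by auto
      then obtain V J where V: "openin W V" "openin unit_interval J" "w \<in> V" "K \<subseteq> J" "V \<times> J \<subseteq> ?P"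
        using tube_lemma_right[OF P K wW] by blast
      have "v \<in> (\<lambda>w. restrict (H w) {0..1}) -` S \<inter> topspace W" if "v \<in> V" for v
      proof -
        have vW: "v \<in> topspace W" using V(1) that openin_subset by blast
        have "restrict (H v) {0..1} t \<in> U" if t: "t \<in> K" for t
        proof -
          have "(v, t) \<in> ?P"
            using V(4,5) \<open>v \<in> V\<close> t by blast
          then show ?thesis
            using subsetD[OF K01 t] by simp
        qed
        then have "restrict (H v) {0..1} ` K \<subseteq> U"
          by blast
        then show ?thesis using path[OF vW] vW by (simp add: S)
      qed
      then show "\<exists>T. openin W T \<and> w \<in> T \<and> T \<subseteq> (\<lambda>w. restrict (H w) {0..1}) -` S \<inter> topspace W"
        using V(1,3) by blast
    qed
  qed
qed

section \<open>Hurewicz fibrations\<close>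

definition homotopy_lifting_property ::
    "'w topology \<Rightarrow> 'e topology \<Rightarrow> 'b topology \<Rightarrow> ('e \<Rightarrow> 'b) \<Rightarrow> bool" where
  "homotopy_lifting_property W E B p \<longleftrightarrow>
     (\<forall>H h. continuous_map (prod_topology W unit_interval) B H \<and> continuous_map W E h \<and>
            (\<forall>w \<in> topspace W. p (h w) = H (w, 0)) \<longrightarrow>
        (\<exists>L. continuous_map (prod_topology W unit_interval) E L \<and>
             (\<forall>w \<in> topspace W. L (w, 0) = h w) \<and>
             (\<forall>w \<in> topspace W. \<forall>t \<in> {0..1}. p (L (w, t)) = H (w, t))))"

text \<open>A fibration has the homotopy lifting property with respect to all spaces. HOL cannot
  quantify over the type of the points of the test space inside a formula, so the definition
  ranges over all topologies on one type. That type is large enough to carry the universal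
  test space $\{(e, \gamma) \in E \times B^I : p(e) = \gamma(0)\}$, and hence nothing is lost:
  by hurewicz_fibration_lifting below, the property then holds for test spaces
  over every type.\<close>

definition hurewicz_fibration :: "'e topology \<Rightarrow> 'b topology \<Rightarrow> ('e \<Rightarrow> 'b) \<Rightarrow> bool" where
  "hurewicz_fibration E B p \<longleftrightarrow> continuous_map E B p \<and>
     (\<forall>W :: ('e \<times> (real \<Rightarrow> 'b)) topology. homotopy_lifting_property W E B p)"

theorem hurewicz_fibration_lifting:
  fixes W :: "'w topology" and E :: "'e topology" and B :: "'b topology"
  assumes fib: "hurewicz_fibration E B p"
  shows "homotopy_lifting_property W E B p"
  unfolding homotopy_lifting_property_def
proof (intro allI impI, elim conjE)
  fix H :: "'w \<times> real \<Rightarrow> 'b" and h :: "'w \<Rightarrow> 'e"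
  assume H: "continuous_map (prod_topology W unit_interval) B H"
    and h: "continuous_map W E h"
    and hH: "\<forall>w \<in> topspace W. p (h w) = H (w, 0)"
  define N where "N = subtopology (prod_topology E (path_space B)) {(e, \<gamma>). p e = \<gamma> 0}"
  have fstN: "continuous_map N E fst"
    unfolding N_def by (intro continuous_map_from_subtopology continuous_map_fst)
  have sndN: "continuous_map N (path_space B) snd"
    unfolding N_def by (intro continuous_map_from_subtopology continuous_map_snd)
  have "continuous_map (prod_topology N unit_interval) (prod_topology (path_space B) unit_interval)
          (\<lambda>(z, t). (snd z, t))"
    using continuous_map_compose[OF continuous_map_fst sndN]
    by (auto simp: continuous_map_pairwise o_def case_prod_unfold continuous_map_snd)
  from continuous_map_compose[OF this continuous_map_path_eval]
  have ev: "continuous_map (prod_topology N unit_interval) B (\<lambda>(z, t). snd z t)"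
    by (simp add: o_def case_prod_unfold)
  have "homotopy_lifting_property N E B p"
    using fib unfolding hurewicz_fibration_def by blast
  moreover have "\<forall>z \<in> topspace N. p (fst z) = (\<lambda>(z, t). snd z t) (z, 0)"
    by (auto simp: N_def)
  ultimately have "\<exists>L. continuous_map (prod_topology N unit_interval) E L \<and>
      (\<forall>z \<in> topspace N. L (z, 0) = fst z) \<and>
      (\<forall>z \<in> topspace N. \<forall>t \<in> {0..1}. p (L (z, t)) = (\<lambda>(z, t). snd z t) (z, t))"
    using ev fstN unfolding homotopy_lifting_property_def
    by (elim allE[where x = "\<lambda>(z, t). snd z t"] allE[where x = fst]) simp
  then obtain L where L: "continuous_map (prod_topology N unit_interval) E L"
    "\<forall>z \<in> topspace N. L (z, 0) = fst z"
    "\<forall>z \<in> topspace N. \<forall>t \<in> {0..1}. p (L (z, t)) = snd z t"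
    by auto
  define q where "q w = (h w, restrict (\<lambda>t. H (w, t)) {0..1})" for w
  have "continuous_map W (path_space B) (\<lambda>w. restrict (\<lambda>t. H (w, t)) {0..1})"
    using H continuous_map_into_path_space[where H = "\<lambda>w t. H (w, t)"] by simp
  then have q: "continuous_map W N q"
    unfolding N_def using h hH
    by (auto simp: q_def continuous_map_in_subtopology continuous_map_pairwise o_def)
  have "continuous_map (prod_topology W unit_interval) (prod_topology N unit_interval) (\<lambda>(w, t). (q w, t))"
    using continuous_map_compose[OF continuous_map_fst q]
    by (auto simp: continuous_map_pairwise o_def case_prod_unfold continuous_map_snd)
  from continuous_map_compose[OF this L(1)]
  have "continuous_map (prod_topology W unit_interval) E (\<lambda>(w, t). L (q w, t))"
    by (simp add: o_def case_prod_unfold)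
  moreover have "q w \<in> topspace N" if "w \<in> topspace W" for w
    using q that by (auto simp: continuous_map_def)
  ultimately show "\<exists>L. continuous_map (prod_topology W unit_interval) E L \<and>
             (\<forall>w \<in> topspace W. L (w, 0) = h w) \<and>
             (\<forall>w \<in> topspace W. \<forall>t \<in> {0..1}. p (L (w, t)) = H (w, t))"
    using L(2,3) by (intro exI[of _ "\<lambda>(w, t). L (q w, t)"]) (auto simp: q_def)
qed

section \<open>Sectional number and sectional category\<close>

text \<open>In \<^typ>\<open>enat\<close> the infimum of the empty set is \<^term>\<open>\<infinity>\<close>, and the infimum of a nonempty set is
  its least element.\<close>

definition sectional_number :: "'e topology \<Rightarrow> 'b topology \<Rightarrow> ('e \<Rightarrow> 'b) \<Rightarrow> enat" where
  "sectional_number E B p = Inf {enat k | k. \<exists>U :: nat \<Rightarrow> 'b set.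
     topspace B = (\<Union>i\<le>k. U i) \<and>
     (\<forall>i\<le>k. openin B (U i) \<and>
        (\<exists>s. continuous_map (subtopology B (U i)) E s \<and> (\<forall>b \<in> U i. p (s b) = b)))}"

definition secat :: "'e topology \<Rightarrow> 'b topology \<Rightarrow> ('e \<Rightarrow> 'b) \<Rightarrow> enat" where
  "secat E B p = Inf {enat k | k. \<exists>U :: nat \<Rightarrow> 'b set.
     topspace B = (\<Union>i\<le>k. U i) \<and>
     (\<forall>i\<le>k. openin B (U i) \<and>
        (\<exists>s. continuous_map (subtopology B (U i)) E s \<and>
             homotopic_with (\<lambda>_. True) (subtopology B (U i)) B (p \<circ> s) id))}"

section \<open>Bivariate topological complexities\<close>

definition Delta_space ::
    "'x topology \<Rightarrow> 'y topology \<Rightarrow> ('x \<Rightarrow> 'z) \<Rightarrow> ('y \<Rightarrow> 'z) \<Rightarrow> ((real \<Rightarrow> 'x) \<times> (real \<Rightarrow> 'y)) topology" where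
  "Delta_space X Y f g = subtopology (prod_topology (path_space X) (path_space Y))
     {(\<alpha>, \<beta>). \<forall>t \<in> {0..1}. f (\<alpha> t) = g (\<beta> t)}"

definition end_map :: "(real \<Rightarrow> 'x) \<times> (real \<Rightarrow> 'y) \<Rightarrow> 'x \<times> 'y" where
  "end_map = (\<lambda>(\<alpha>, \<beta>). (\<alpha> 0, \<beta> 1))"

definition TC :: "'x topology \<Rightarrow> 'y topology \<Rightarrow> ('x \<Rightarrow> 'z) \<Rightarrow> ('y \<Rightarrow> 'z) \<Rightarrow> enat" where
  "TC X Y f g = sectional_number (Delta_space X Y f g) (prod_topology X Y) end_map"

definition fg_sectional ::
    "'x topology \<Rightarrow> 'y topology \<Rightarrow> 'z topology \<Rightarrow> ('x \<Rightarrow> 'z) \<Rightarrow> ('y \<Rightarrow> 'z) \<Rightarrow> ('x \<times> 'y) set \<Rightarrow> bool" where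
  "fg_sectional X Y Z f g A \<longleftrightarrow> A \<subseteq> topspace (prod_topology X Y) \<and>
     (\<exists>\<sigma>. continuous_map (subtopology (prod_topology X Y) A) (path_space Z) \<sigma> \<and>
          (\<forall>(x, y) \<in> A. \<sigma> (x, y) 0 = f x \<and> \<sigma> (x, y) 1 = g y))"

definition TC_H ::
    "'x topology \<Rightarrow> 'y topology \<Rightarrow> 'z topology \<Rightarrow> ('x \<Rightarrow> 'z) \<Rightarrow> ('y \<Rightarrow> 'z) \<Rightarrow> enat" where
  "TC_H X Y Z f g = Inf {enat k | k. \<exists>U :: nat \<Rightarrow> ('x \<times> 'y) set.
     topspace (prod_topology X Y) = (\<Union>i\<le>k. U i) \<and>
     (\<forall>i\<le>k. openin (prod_topology X Y) (U i) \<and> fg_sectional X Y Z f g (U i))}"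

end

theory Submission
  imports Defs
begin

text \<open>Write \<open>W\<close> for an open subset of \<open>X \<times> Y\<close> with its subspace topology. By adjunction, a map
  \<open>W \<rightarrow> Z\<^sup>I\<close> is a homotopy, so \<open>W\<close> is \<open>(f, g)\<close>-sectional exactly when \<open>f \<circ> fst\<close> and \<open>g \<circ> snd\<close> are
  homotopic on \<open>W\<close> (\<open>fg_sectional_iff_homotopic\<close>). All three invariants count the members of open
  covers whose members satisfy some condition, so they are compared by comparing the conditions on
  a single \<open>W\<close>.

  A homotopy section \<open>s\<close> of the end map \<open>(\<alpha>, \<beta>) \<mapsto> (\<alpha> 0, \<beta> 1)\<close> over \<open>W\<close> makes \<open>W\<close> sectional without
  any assumption on \<open>f\<close> and \<open>g\<close> (\<open>homotopy_section_imp_fg_sectional\<close>): on the space of pairs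
  \<open>(\<alpha>, \<beta>)\<close> with \<open>f \<circ> \<alpha> = g \<circ> \<beta>\<close>, the map \<open>(\<alpha>, \<beta>) \<mapsto> f (\<alpha> 0)\<close> is homotopic to \<open>(\<alpha>, \<beta>) \<mapsto> g (\<beta> 1)\<close>
  by moving along the common path in \<open>Z\<close>, and precomposing with \<open>s\<close> gives, up to homotopy,
  \<open>f \<circ> fst\<close> and \<open>g \<circ> snd\<close>. Hence the homotopy complexity is at most \<open>secat\<close>, which is at most the
  sectional number.

  Conversely, let \<open>f \<circ> fst\<close> and \<open>g \<circ> snd\<close> be homotopic on \<open>W\<close>. If \<open>f\<close> is a fibration, lifting the
  homotopy with initial map \<open>fst\<close> deforms \<open>fst\<close> to a map \<open>a\<close> with \<open>f \<circ> a = g \<circ> snd\<close>; the constant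
  paths at \<open>a\<close> and at \<open>snd\<close> then form a homotopy section. If \<open>g\<close> is a fibration, \<open>snd\<close> is deformed
  instead (\<open>fibration_imp_homotopy_section\<close>). If both are fibrations, the paths in \<open>Z\<close> are lifted
  through \<open>f\<close> from their initial points and, run backwards, through \<open>g\<close> from their end points. The
  two lifts lie over the same path, so they form a strict section
  (\<open>fibrations_imp_strict_section\<close>).\<close>

section \<open>Homotopies and path spaces\<close>

lemma homotopic_with_iff_homotopy_swapped:
  "homotopic_with (\<lambda>_. True) W Y p q \<longleftrightarrow>
    (\<exists>h. continuous_map (prod_topology W unit_interval) Y h \<and>
         (\<forall>w \<in> topspace W. h (w, 0) = p w \<and> h (w, 1) = q w))"
proof
  assume "homotopic_with (\<lambda>_. True) W Y p q"
  then obtain h where h: "continuous_map (prod_topology unit_interval W) Y h"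
    and ends: "\<forall>w. h (0, w) = p w" "\<forall>w. h (1, w) = q w"
    unfolding homotopic_with_def by blast
  have "continuous_map (prod_topology W unit_interval) Y (h \<circ> (\<lambda>(w, t). (t, w)))"
    by (rule continuous_map_compose[OF _ h])
      (simp add: continuous_map_pairwise o_def case_prod_unfold continuous_map_fst continuous_map_snd)
  then show "\<exists>h. continuous_map (prod_topology W unit_interval) Y h \<and>
         (\<forall>w \<in> topspace W. h (w, 0) = p w \<and> h (w, 1) = q w)"
    using ends by (intro exI[of _ "h \<circ> (\<lambda>(w, t). (t, w))"]) auto
next
  assume "\<exists>h. continuous_map (prod_topology W unit_interval) Y h \<and>
         (\<forall>w \<in> topspace W. h (w, 0) = p w \<and> h (w, 1) = q w)"
  then obtain h where h: "continuous_map (prod_topology W unit_interval) Y h"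
    and ends: "\<forall>w \<in> topspace W. h (w, 0) = p w \<and> h (w, 1) = q w"
    by blast
  have "continuous_map (prod_topology unit_interval W) Y (h \<circ> (\<lambda>(t, w). (w, t)))"
    by (rule continuous_map_compose[OF _ h])
      (simp add: continuous_map_pairwise o_def case_prod_unfold continuous_map_fst continuous_map_snd)
  then show "homotopic_with (\<lambda>_. True) W Y p q"
    using ends by (subst homotopic_with) (auto intro!: exI[of _ "h \<circ> (\<lambda>(t, w). (w, t))"])
qed

lemma homotopic_with_pair:
  assumes "homotopic_with (\<lambda>_. True) W X a a'" "homotopic_with (\<lambda>_. True) W Y b b'"
  shows "homotopic_with (\<lambda>_. True) W (prod_topology X Y) (\<lambda>w. (a w, b w)) (\<lambda>w. (a' w, b' w))"
proof -
  have diag: "continuous_map W (prod_topology W W) (\<lambda>w. (w, w))"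
    by (simp add: continuous_map_pairwise o_def)
  show ?thesis
    using homotopic_with_compose_continuous_map_right
      [OF homotopic_with_prod_topology[OF assms, where r = "\<lambda>_. True"] diag, where q = "\<lambda>_. True"]
    by (simp add: o_def)
qed

text \<open>The direction of the adjunction between paths and homotopies that turns a map into the path
  space into a homotopy.\<close>

lemma continuous_map_from_path_space:
  assumes "continuous_map W (path_space X) \<sigma>"
  shows "continuous_map (prod_topology W unit_interval) X (\<lambda>(w, t). \<sigma> w t)"
proof -
  have "continuous_map (prod_topology W unit_interval) (prod_topology (path_space X) unit_interval)
          (\<lambda>(w, t). (\<sigma> w, t))"
    using continuous_map_compose[OF continuous_map_fst assms]
    by (auto simp: continuous_map_pairwise o_def case_prod_unfold continuous_map_snd)
  from continuous_map_compose[OF this continuous_map_path_eval] show ?thesis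
    by (simp add: o_def case_prod_unfold)
qed

lemma continuous_map_prod_unit_interval_reverse:
  assumes "continuous_map (prod_topology W unit_interval) X H"
  shows "continuous_map (prod_topology W unit_interval) X (\<lambda>(w, t). H (w, 1 - t))"
proof -
  have rev: "continuous_map unit_interval unit_interval (\<lambda>t. 1 - t)"
    by (auto simp: continuous_map_in_subtopology intro!: continuous_intros)
  have "continuous_map (prod_topology W unit_interval) (prod_topology W unit_interval)
          (\<lambda>(w, t). (w, 1 - t))"
    using continuous_map_compose[OF continuous_map_snd rev]
    by (auto simp: continuous_map_pairwise o_def case_prod_unfold continuous_map_fst)
  from continuous_map_compose[OF this assms] show ?thesis
    by (simp add: o_def case_prod_unfold)
qed

lemma fg_sectional_iff_homotopic:
  assumes "A \<subseteq> topspace (prod_topology X Y)"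
  shows "fg_sectional X Y Z f g A \<longleftrightarrow>
    homotopic_with (\<lambda>_. True) (subtopology (prod_topology X Y) A) Z (f \<circ> fst) (g \<circ> snd)"
    (is "_ \<longleftrightarrow> homotopic_with _ ?W Z _ _")
proof
  have topA: "topspace ?W = A"
    using assms by auto
  {
    assume "fg_sectional X Y Z f g A"
    then obtain \<sigma> where \<sigma>: "continuous_map ?W (path_space Z) \<sigma>"
      and ends: "\<forall>(x, y) \<in> A. \<sigma> (x, y) 0 = f x \<and> \<sigma> (x, y) 1 = g y"
      unfolding fg_sectional_def by blast
    show "homotopic_with (\<lambda>_. True) ?W Z (f \<circ> fst) (g \<circ> snd)"
      unfolding homotopic_with_iff_homotopy_swapped topA
      using continuous_map_from_path_space[OF \<sigma>] ends
      by (intro exI[of _ "\<lambda>(w, t). \<sigma> w t"]) auto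
  next
    assume "homotopic_with (\<lambda>_. True) ?W Z (f \<circ> fst) (g \<circ> snd)"
    then obtain h where h: "continuous_map (prod_topology ?W unit_interval) Z h"
      and ends: "\<forall>w \<in> A. h (w, 0) = (f \<circ> fst) w \<and> h (w, 1) = (g \<circ> snd) w"
      unfolding homotopic_with_iff_homotopy_swapped topA by blast
    have "continuous_map ?W (path_space Z) (\<lambda>w. restrict (\<lambda>t. h (w, t)) {0..1})"
      using h by (intro continuous_map_into_path_space) simp
    then show "fg_sectional X Y Z f g A"
      unfolding fg_sectional_def using ends assms
      by (intro conjI exI[of _ "\<lambda>w. restrict (\<lambda>t. h (w, t)) {0..1}"]) auto
  }
qed

section \<open>The space of pairs of paths over a common path\<close>

lemma continuous_map_into_Delta_space:
  assumes A: "continuous_map (prod_topology W unit_interval) X (\<lambda>(w, t). A w t)"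
    and B: "continuous_map (prod_topology W unit_interval) Y (\<lambda>(w, t). B w t)"
    and eq: "\<And>w t. w \<in> topspace W \<Longrightarrow> t \<in> {0..1} \<Longrightarrow> f (A w t) = g (B w t)"
  shows "continuous_map W (Delta_space X Y f g)
    (\<lambda>w. (restrict (A w) {0..1}, restrict (B w) {0..1}))"
  unfolding Delta_space_def continuous_map_in_subtopology
  using continuous_map_into_path_space[OF A] continuous_map_into_path_space[OF B] eq
  by (auto simp: continuous_map_pairwise o_def)

lemma continuous_map_Delta_space_fst: "continuous_map (Delta_space X Y f g) (path_space X) fst"
  and continuous_map_Delta_space_snd: "continuous_map (Delta_space X Y f g) (path_space Y) snd"
  unfolding Delta_space_def
  by (simp_all add: continuous_map_from_subtopology continuous_map_fst continuous_map_snd)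

text \<open>The homotopy moves along the common image path \<open>f \<circ> \<alpha> = g \<circ> \<beta>\<close>.\<close>

lemma Delta_space_ends_homotopic:
  assumes f: "continuous_map X Z f"
  shows "homotopic_with (\<lambda>_. True) (Delta_space X Y f g) Z (f \<circ> (fst \<circ> end_map)) (g \<circ> (snd \<circ> end_map))"
proof -
  have "continuous_map (prod_topology (Delta_space X Y f g) unit_interval) Z (f \<circ> (\<lambda>(w, t). fst w t))"
    by (rule continuous_map_compose
        [OF continuous_map_from_path_space[OF continuous_map_Delta_space_fst] f])
  then show ?thesis
    unfolding homotopic_with_iff_homotopy_swapped
    by (intro exI[of _ "f \<circ> (\<lambda>(w, t). fst w t)"]) (auto simp: Delta_space_def end_map_def)
qed

section \<open>Comparison over a single open set\<close>

lemma homotopy_section_imp_fg_sectional: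
  assumes f: "continuous_map X Z f" and g: "continuous_map Y Z g"
    and A: "A \<subseteq> topspace (prod_topology X Y)"
    and s: "continuous_map (subtopology (prod_topology X Y) A) (Delta_space X Y f g) s"
    and hom: "homotopic_with (\<lambda>_. True) (subtopology (prod_topology X Y) A) (prod_topology X Y)
      (end_map \<circ> s) id"
  shows "fg_sectional X Y Z f g A"
proof -
  let ?H = "homotopic_with (\<lambda>_. True) (subtopology (prod_topology X Y) A) Z"
  have "?H ((f \<circ> fst) \<circ> (end_map \<circ> s)) ((f \<circ> fst) \<circ> id)"
    by (rule homotopic_with_compose_continuous_map_left[OF hom])
      (auto intro: continuous_map_compose[OF continuous_map_fst f])
  moreover have "?H ((g \<circ> snd) \<circ> (end_map \<circ> s)) ((g \<circ> snd) \<circ> id)"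
    by (rule homotopic_with_compose_continuous_map_left[OF hom])
      (auto intro: continuous_map_compose[OF continuous_map_snd g])
  moreover have "?H ((f \<circ> (fst \<circ> end_map)) \<circ> s) ((g \<circ> (snd \<circ> end_map)) \<circ> s)"
    by (rule homotopic_with_compose_continuous_map_right[OF Delta_space_ends_homotopic[OF f] s]) simp
  ultimately have "?H (f \<circ> fst) (g \<circ> snd)"
    by (simp add: o_assoc) (meson homotopic_with_symD homotopic_with_trans)
  then show ?thesis
    by (simp add: fg_sectional_iff_homotopic[OF A])
qed

lemma hurewicz_fibration_obtains_lift:
  assumes p: "hurewicz_fibration E B p"
    and H: "continuous_map (prod_topology W unit_interval) B H" and h: "continuous_map W E h"
    and start: "\<And>w. w \<in> topspace W \<Longrightarrow> p (h w) = H (w, 0)"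
  obtains L where "continuous_map (prod_topology W unit_interval) E L"
    "\<forall>w \<in> topspace W. L (w, 0) = h w"
    "\<forall>w \<in> topspace W. \<forall>t \<in> {0..1}. p (L (w, t)) = H (w, t)"
proof -
  have "\<exists>L. continuous_map (prod_topology W unit_interval) E L \<and>
      (\<forall>w \<in> topspace W. L (w, 0) = h w) \<and>
      (\<forall>w \<in> topspace W. \<forall>t \<in> {0..1}. p (L (w, t)) = H (w, t))"
    by (rule hurewicz_fibration_lifting
        [OF p, of W, unfolded homotopy_lifting_property_def, rule_format, of H h])
      (use H h start in auto)
  then show thesis
    using that by blast
qed

lemma hurewicz_fibration_deform:
  assumes p: "hurewicz_fibration E B p" and h: "continuous_map W E h"
    and hom: "homotopic_with (\<lambda>_. True) W B (p \<circ> h) k"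
  obtains h' where "homotopic_with (\<lambda>_. True) W E h h'" "\<forall>w \<in> topspace W. p (h' w) = k w"
proof -
  obtain H where H: "continuous_map (prod_topology W unit_interval) B H"
    and ends: "\<forall>w \<in> topspace W. H (w, 0) = (p \<circ> h) w \<and> H (w, 1) = k w"
    using hom unfolding homotopic_with_iff_homotopy_swapped by blast
  have "p (h w) = H (w, 0)" if "w \<in> topspace W" for w
    using ends that by simp
  then obtain L where L: "continuous_map (prod_topology W unit_interval) E L"
    "\<forall>w \<in> topspace W. L (w, 0) = h w"
    "\<forall>w \<in> topspace W. \<forall>t \<in> {0..1}. p (L (w, t)) = H (w, t)"
    by (rule hurewicz_fibration_obtains_lift[OF p H h])
  show thesis
  proof
    show "homotopic_with (\<lambda>_. True) W E h (\<lambda>w. L (w, 1))"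
      unfolding homotopic_with_iff_homotopy_swapped using L(1,2) by (intro exI[of _ L]) simp
    show "\<forall>w \<in> topspace W. p (L (w, 1)) = k w"
      using L(3) ends by simp
  qed
qed

text \<open>If the two coordinate maps can be deformed to a map \<open>(a, b)\<close> with values in the strict pullback
  of \<open>f\<close> and \<open>g\<close>, the constant paths at \<open>a\<close> and \<open>b\<close> form a homotopy section of the end map.\<close>

lemma deformation_into_pullback_imp_homotopy_section:
  assumes a: "homotopic_with (\<lambda>_. True) W X fst a" and b: "homotopic_with (\<lambda>_. True) W Y snd b"
    and eq: "\<And>w. w \<in> topspace W \<Longrightarrow> f (a w) = g (b w)"
  shows "\<exists>s. continuous_map W (Delta_space X Y f g) s \<and>
    homotopic_with (\<lambda>_. True) W (prod_topology X Y) (end_map \<circ> s) id"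
proof (intro exI conjI)
  let ?s = "\<lambda>w. (restrict (\<lambda>t. a w) {0..1}, restrict (\<lambda>t. b w) {0..1})"
  have "continuous_map W X a" "continuous_map W Y b"
    using a b homotopic_with_imp_continuous_maps by blast+
  then have "continuous_map (prod_topology W unit_interval) X (a \<circ> fst)"
    "continuous_map (prod_topology W unit_interval) Y (b \<circ> fst)"
    by (blast intro: continuous_map_compose continuous_map_fst)+
  then show "continuous_map W (Delta_space X Y f g) ?s"
    using eq by (intro continuous_map_into_Delta_space) (simp_all add: o_def case_prod_unfold)
  have "homotopic_with (\<lambda>_. True) W (prod_topology X Y) (\<lambda>w. (a w, b w)) (\<lambda>w. (fst w, snd w))"
    by (intro homotopic_with_pair homotopic_with_symD[OF a] homotopic_with_symD[OF b])
  then show "homotopic_with (\<lambda>_. True) W (prod_topology X Y) (end_map \<circ> ?s) id"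
    by (simp add: o_def end_map_def id_def)
qed

lemma fibration_imp_homotopy_section:
  assumes fib: "hurewicz_fibration X Z f \<or> hurewicz_fibration Y Z g"
    and sec: "fg_sectional X Y Z f g A"
  shows "\<exists>s. continuous_map (subtopology (prod_topology X Y) A) (Delta_space X Y f g) s \<and>
    homotopic_with (\<lambda>_. True) (subtopology (prod_topology X Y) A) (prod_topology X Y)
      (end_map \<circ> s) id"
proof -
  let ?W = "subtopology (prod_topology X Y) A"
  have fst: "continuous_map ?W X fst" and snd: "continuous_map ?W Y snd"
    by (simp_all add: continuous_map_from_subtopology continuous_map_fst continuous_map_snd)
  have "A \<subseteq> topspace (prod_topology X Y)"
    using sec unfolding fg_sectional_def by blast
  then have hom: "homotopic_with (\<lambda>_. True) ?W Z (f \<circ> fst) (g \<circ> snd)"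
    using fg_sectional_iff_homotopic sec by blast
  from fib show ?thesis
  proof
    assume fib: "hurewicz_fibration X Z f"
    obtain a where "homotopic_with (\<lambda>_. True) ?W X fst a"
      "\<forall>w \<in> topspace ?W. f (a w) = (g \<circ> snd) w"
      by (rule hurewicz_fibration_deform[OF fib fst hom])
    with snd show ?thesis
      by (intro deformation_into_pullback_imp_homotopy_section[where a = a and b = snd]) simp_all
  next
    assume fib: "hurewicz_fibration Y Z g"
    obtain b where "homotopic_with (\<lambda>_. True) ?W Y snd b"
      "\<forall>w \<in> topspace ?W. g (b w) = (f \<circ> fst) w"
      by (rule hurewicz_fibration_deform[OF fib snd homotopic_with_symD[OF hom]])
    with fst show ?thesis
      by (intro deformation_into_pullback_imp_homotopy_section[where a = fst and b = b]) simp_all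
  qed
qed

lemma fibrations_imp_strict_section:
  assumes f: "hurewicz_fibration X Z f" and g: "hurewicz_fibration Y Z g"
    and sec: "fg_sectional X Y Z f g A"
  shows "\<exists>s. continuous_map (subtopology (prod_topology X Y) A) (Delta_space X Y f g) s \<and>
    (\<forall>w \<in> A. end_map (s w) = w)"
proof -
  let ?W = "subtopology (prod_topology X Y) A"
  have topA: "topspace ?W = A"
    using sec unfolding fg_sectional_def by auto
  have fst: "continuous_map ?W X fst" and snd: "continuous_map ?W Y snd"
    by (simp_all add: continuous_map_from_subtopology continuous_map_fst continuous_map_snd)
  obtain \<sigma> where \<sigma>: "continuous_map ?W (path_space Z) \<sigma>"
    and ends: "\<forall>(x, y) \<in> A. \<sigma> (x, y) 0 = f x \<and> \<sigma> (x, y) 1 = g y"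
    using sec unfolding fg_sectional_def by blast
  have ends': "\<sigma> w 0 = f (fst w)" "\<sigma> w 1 = g (snd w)" if "w \<in> topspace ?W" for w
    using bspec[OF ends, of w] that unfolding topA by (simp_all add: case_prod_unfold)
  let ?H = "\<lambda>(w, t). \<sigma> w t"
  let ?R = "\<lambda>(w, t). \<sigma> w (1 - t)"
  have H: "continuous_map (prod_topology ?W unit_interval) Z ?H"
    by (rule continuous_map_from_path_space[OF \<sigma>])
  have R: "continuous_map (prod_topology ?W unit_interval) Z ?R"
    using continuous_map_prod_unit_interval_reverse[OF H] by simp
  have "f (fst w) = ?H (w, 0)" if "w \<in> topspace ?W" for w
    using ends'(1)[OF that] by simp
  from hurewicz_fibration_obtains_lift[OF f H fst this]
  obtain L where L: "continuous_map (prod_topology ?W unit_interval) X L"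
    "\<forall>w \<in> topspace ?W. L (w, 0) = fst w"
    "\<forall>w \<in> topspace ?W. \<forall>t \<in> {0..1}. f (L (w, t)) = ?H (w, t)"
    .
  have "g (snd w) = ?R (w, 0)" if "w \<in> topspace ?W" for w
    using ends'(2)[OF that] by simp
  from hurewicz_fibration_obtains_lift[OF g R snd this]
  obtain M where M: "continuous_map (prod_topology ?W unit_interval) Y M"
    "\<forall>w \<in> topspace ?W. M (w, 0) = snd w"
    "\<forall>w \<in> topspace ?W. \<forall>t \<in> {0..1}. g (M (w, t)) = ?R (w, t)"
    .
  \<comment> \<open>\<open>M\<close> starts at the point of \<open>Y\<close> and lies over the reversed path; reversing it again makes both
    components lie over \<open>\<sigma> w\<close>.\<close>
  let ?s = "\<lambda>w. (restrict (\<lambda>t. L (w, t)) {0..1}, restrict (\<lambda>t. M (w, 1 - t)) {0..1})"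
  have "continuous_map ?W (Delta_space X Y f g) ?s"
  proof (rule continuous_map_into_Delta_space)
    show "continuous_map (prod_topology ?W unit_interval) X (\<lambda>(w, t). L (w, t))"
      using L(1) by simp
    show "continuous_map (prod_topology ?W unit_interval) Y (\<lambda>(w, t). M (w, 1 - t))"
      by (rule continuous_map_prod_unit_interval_reverse[OF M(1)])
    show "f (L (w, t)) = g (M (w, 1 - t))" if "w \<in> topspace ?W" "t \<in> {0..1}" for w t
      using that L(3) M(3) by simp
  qed
  moreover have "\<forall>w \<in> A. end_map (?s w) = w"
    using L(2) M(2) unfolding topA by (simp add: end_map_def)
  ultimately show ?thesis
    by (intro exI[of _ ?s] conjI)
qed

section \<open>Comparison of the invariants\<close>

lemma Inf_open_cover_mono:
  assumes "\<And>U. openin B U \<Longrightarrow> Q U \<Longrightarrow> P U"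
  shows "Inf {enat k | k. \<exists>U :: nat \<Rightarrow> 'b set.
           topspace B = (\<Union>i\<le>k. U i) \<and> (\<forall>i\<le>k. openin B (U i) \<and> P (U i))}
       \<le> Inf {enat k | k. \<exists>U :: nat \<Rightarrow> 'b set.
           topspace B = (\<Union>i\<le>k. U i) \<and> (\<forall>i\<le>k. openin B (U i) \<and> Q (U i))}"
proof (rule Inf_superset_mono, rule subsetI, elim CollectE exE conjE)
  fix x k and U :: "nat \<Rightarrow> 'b set"
  assume "x = enat k" "topspace B = (\<Union>i\<le>k. U i)" "\<forall>i\<le>k. openin B (U i) \<and> Q (U i)"
  then show "x \<in> {enat k | k. \<exists>U :: nat \<Rightarrow> 'b set.
      topspace B = (\<Union>i\<le>k. U i) \<and> (\<forall>i\<le>k. openin B (U i) \<and> P (U i))}"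
    using assms by (intro CollectI exI[of _ k] exI[of _ U] conjI) simp_all
qed

lemma secat_le_sectional_number: "secat E B p \<le> sectional_number E B p"
  unfolding secat_def sectional_number_def
proof (rule Inf_open_cover_mono)
  fix U assume "openin B U"
    and "\<exists>s. continuous_map (subtopology B U) E s \<and> (\<forall>b \<in> U. p (s b) = b)"
  then obtain s where s: "continuous_map (subtopology B U) E s" "\<forall>b \<in> U. p (s b) = b"
    by blast
  have "homotopic_with (\<lambda>_. True) (subtopology B U) B id (p \<circ> s)"
    using s(2) by (intro homotopic_with_equal) (auto simp: continuous_map_from_subtopology)
  then show "\<exists>s. continuous_map (subtopology B U) E s \<and>
      homotopic_with (\<lambda>_. True) (subtopology B U) B (p \<circ> s) id"
    using s(1) homotopic_with_symD by blast
qed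

lemma TC_H_le_secat:
  assumes "continuous_map X Z f" "continuous_map Y Z g"
  shows "TC_H X Y Z f g \<le> secat (Delta_space X Y f g) (prod_topology X Y) end_map"
  unfolding TC_H_def secat_def
proof (rule Inf_open_cover_mono, elim exE conjE)
  fix U s assume "openin (prod_topology X Y) U"
    and "continuous_map (subtopology (prod_topology X Y) U) (Delta_space X Y f g) s"
    and "homotopic_with (\<lambda>_. True) (subtopology (prod_topology X Y) U) (prod_topology X Y)
      (end_map \<circ> s) id"
  then show "fg_sectional X Y Z f g U"
    by (intro homotopy_section_imp_fg_sectional[OF assms] openin_subset)
qed

theorem proposition6p3:
  fixes X :: "'x topology" and Y :: "'y topology" and Z :: "'z topology"
    and f :: "'x \<Rightarrow> 'z" and g :: "'y \<Rightarrow> 'z"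
  assumes "continuous_map X Z f" and "continuous_map Y Z g"
  shows "TC_H X Y Z f g \<le> TC X Y f g \<and>
    (hurewicz_fibration X Z f \<or> hurewicz_fibration Y Z g \<longrightarrow>
       TC_H X Y Z f g = secat (Delta_space X Y f g) (prod_topology X Y) end_map) \<and>
    (hurewicz_fibration X Z f \<and> hurewicz_fibration Y Z g \<longrightarrow>
       TC_H X Y Z f g = TC X Y f g)"
proof -
  let ?D = "Delta_space X Y f g" and ?B = "prod_topology X Y"
  note le_secat = TC_H_le_secat[OF assms]
  have le_TC: "TC_H X Y Z f g \<le> TC X Y f g"
    unfolding TC_def using le_secat secat_le_sectional_number by (rule order_trans)
  have "secat ?D ?B end_map \<le> TC_H X Y Z f g"
    if "hurewicz_fibration X Z f \<or> hurewicz_fibration Y Z g"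
    unfolding TC_H_def secat_def
    by (rule Inf_open_cover_mono) (rule fibration_imp_homotopy_section[OF that])
  moreover have "TC X Y f g \<le> TC_H X Y Z f g"
    if "hurewicz_fibration X Z f" "hurewicz_fibration Y Z g"
    unfolding TC_H_def TC_def sectional_number_def
    by (rule Inf_open_cover_mono) (rule fibrations_imp_strict_section[OF that])
  ultimately show ?thesis
    using le_secat le_TC by (blast intro: antisym)
qed

end
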